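(* For every $n>3$, the complete graph $K_n$ is not $132$-representable by a $2$-uniform word; that is, for no labeling of its vertices by distinct elements of a totally ordered set is it represented by a $132$-avoiding word in which every letter occurs exactly twice.
   Context: A word is a finite sequence of letters from a totally ordered alphabet. Two letters $x,y$ alternate in a word $w$ if between any two occurrences of $x$ there is an occurrence of $y$ and between any two occurrences of $y$ there is an occurrence of $x$. A graph $G=(V,E)$ is represented by a word $w$ over $V$ if for all distinct $x,y\in V$, $x$ and $y$ alternate in $w$ if and only if $xy\in E$. A word $w_1\cdots w_n$ contains the pattern $132$ if there are indices $i<j<l$ with $w_i<w_l<w_j$, and is $132$-avoiding otherwise. *)

theory Defs
  imports "Graph_Theory.Kuratowski"
begin

text \<open>
  Graphs are those of the entry Graph_Theory: the locale \<open>graph\<close> describes finite simple graphs,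
  an undirected edge between \<open>x\<close> and \<open>y\<close> being the two opposite arcs, so that \<open>xy\<close> is an edge iff
  \<open>(x, y) \<in> arcs_ends G\<close>; \<open>complete_digraph n G\<close> says that \<open>G\<close> is a complete graph on \<open>n\<close> vertices.
  Words are lists.
\<close>

definition alternate :: "'a \<Rightarrow> 'a \<Rightarrow> 'a list \<Rightarrow> bool" where
  "alternate x y w \<longleftrightarrow>
     (\<forall>i j. i < j \<and> j < length w \<and> w ! i = x \<and> w ! j = x \<longrightarrow> (\<exists>k. i < k \<and> k < j \<and> w ! k = y)) \<and>
     (\<forall>i j. i < j \<and> j < length w \<and> w ! i = y \<and> w ! j = y \<longrightarrow> (\<exists>k. i < k \<and> k < j \<and> w ! k = x))"

definition represents :: "'a list \<Rightarrow> ('a, 'e) pre_digraph \<Rightarrow> bool" where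
  "represents w G \<longleftrightarrow> set w \<subseteq> verts G \<and>
     (\<forall>x\<in>verts G. \<forall>y\<in>verts G. x \<noteq> y \<longrightarrow> (alternate x y w \<longleftrightarrow> (x, y) \<in> arcs_ends G))"

text \<open>
  Uniformity refers to the alphabet \<open>V\<close>, not to \<open>set w\<close>: every vertex must occur.
  (Two letters that do not occur at all alternate vacuously.)
\<close>
definition uniform_word :: "nat \<Rightarrow> 'a set \<Rightarrow> 'a list \<Rightarrow> bool" where
  "uniform_word k V w \<longleftrightarrow> set w \<subseteq> V \<and> (\<forall>x\<in>V. count_list w x = k)"

definition contains_132 :: "'a::linorder list \<Rightarrow> bool" where
  "contains_132 w \<longleftrightarrow>
     (\<exists>i j l. i < j \<and> j < l \<and> l < length w \<and> w ! i < w ! l \<and> w ! l < w ! j)"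

definition avoids_132 :: "'a::linorder list \<Rightarrow> bool" where
  "avoids_132 w \<longleftrightarrow> \<not> contains_132 w"

text \<open>The graph \<open>G\<close> with every vertex \<open>v\<close> replaced by its label \<open>f v\<close>; used for \<open>f\<close> injective on
  the vertices, so that the result is isomorphic to \<open>G\<close>.\<close>
definition relabel :: "('v \<Rightarrow> 'a) \<Rightarrow> ('v, 'e) pre_digraph \<Rightarrow> ('a, 'e) pre_digraph" where
  "relabel f G = \<lparr>verts = f ` verts G, arcs = arcs G, tail = f \<circ> tail G, head = f \<circ> head G\<rparr>"

end

theory Submission
  imports Defs
begin

text \<open>
  If two letters occurring twice alternate, both first occurrences precede both second ones, and
  the letters appear in the same order in both rounds. So a 2-uniform word representing a complete
  graph has the form \<open>pp\<close> with \<open>p\<close> a permutation. For letters \<open>x < y < z\<close>, the subsequence \<open>x z y\<close>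
  is missing from \<open>pp\<close> only if \<open>p\<close> lists them in the order \<open>y z x\<close>. Given \<open>a < b < c < d\<close>, the triple
  \<open>a, b, c\<close> puts \<open>b\<close> before \<open>c\<close> while \<open>b, c, d\<close> puts \<open>c\<close> before \<open>b\<close>.
\<close>

text \<open>The set equation also excludes a third occurrence, and \<open>p < q\<close> fixes which
  position is the first. Alternation thereby turns into inequalities between positions.\<close>

definition occurs_at :: "'a list \<Rightarrow> 'a \<Rightarrow> nat \<Rightarrow> nat \<Rightarrow> bool" where
  "occurs_at w x p q \<longleftrightarrow> p < q \<and> {i. i < length w \<and> w ! i = x} = {p, q}"

lemma occurs_at_iff: "occurs_at w x p q \<Longrightarrow> i < length w \<and> w ! i = x \<longleftrightarrow> i = p \<or> i = q"
  unfolding occurs_at_def by blast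

lemma count_list_2_occurs_at:
  assumes "count_list w x = 2"
  obtains p q where "occurs_at w x p q"
proof -
  have "card {i. i < length w \<and> w ! i = x} = 2"
    using assms by (simp add: count_list_eq_length_filter length_filter_conv_card eq_commute[of x])
  then obtain p q where pq: "{i. i < length w \<and> w ! i = x} = {p, q}" "p \<noteq> q"
    by (auto simp: card_2_iff)
  show thesis
  proof (cases "p < q")
    case True
    with pq that show thesis unfolding occurs_at_def by blast
  next
    case False
    with pq have "occurs_at w x q p" unfolding occurs_at_def by auto
    with that show thesis .
  qed
qed

lemma alternate_commute: "alternate x y w \<longleftrightarrow> alternate y x w"
  unfolding alternate_def by blast

lemma alternate_between:
  assumes "alternate x y w" and x: "occurs_at w x p q" and y: "occurs_at w y p' q'"
  shows "p < p' \<and> p' < q \<or> p < q' \<and> q' < q"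
proof -
  have "p < q" "q < length w" "w ! p = x" "w ! q = x"
    using x occurs_at_iff[OF x] by (auto simp: occurs_at_def)
  with assms(1) obtain k where k: "p < k" "k < q" "w ! k = y"
    unfolding alternate_def by blast
  with \<open>q < length w\<close> have "k = p' \<or> k = q'"
    using occurs_at_iff[OF y, of k] by simp
  with k show ?thesis by blast
qed

text \<open>Each letter has an occurrence strictly inside the gap of the other. This rules out
  disjoint and nested gaps, so the two gaps cross.\<close>

lemma alternate_occurs_at:
  assumes "alternate x y w" and x: "occurs_at w x p q" and y: "occurs_at w y p' q'"
  shows "p < p' \<and> p' < q \<and> q < q' \<or> p' < p \<and> p < q' \<and> q' < q"
  using alternate_between[OF assms]
    alternate_between[OF alternate_commute[THEN iffD1, OF assms(1)] y x]
  by linarith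

lemma avoids_132_occurs_at_order:
  assumes av: "avoids_132 w" and less: "x < y" "y < z"
    and alt: "alternate x y w" "alternate x z w" "alternate y z w"
    and x: "occurs_at w x p1 q1" and y: "occurs_at w y p2 q2" and z: "occurs_at w z p3 q3"
  shows "p2 < p3 \<and> p3 < p1"
proof -
  \<comment> \<open>Smallest, largest, middle is the pattern 132, whichever copy of each letter is
    taken.\<close>
  have no: "\<not> (i < j \<and> j < l)"
    if "i \<in> {p1, q1}" "j \<in> {p3, q3}" "l \<in> {p2, q2}" for i j l
  proof -
    have "w ! i = x" "w ! j = z" "w ! l = y" "l < length w"
      using that occurs_at_iff[OF x, of i] occurs_at_iff[OF z, of j] occurs_at_iff[OF y, of l]
      by auto
    with av less show ?thesis
      unfolding avoids_132_def contains_132_def by blast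
  qed
  have "p2 < p3 \<or> p3 < p2"
    using alternate_occurs_at[OF alt(3) y z] by linarith
  \<comment> \<open>Here \<open>x\<close> is taken from the first round and \<open>y\<close> from
    the second. Alternation gives \<open>p1 < q3\<close> and \<open>p3 < q2\<close>, so the first
    fact forces \<open>q2 < q3\<close>, hence \<open>p2 < p3\<close>, and the second forces
    \<open>p3 < p1\<close>.\<close>
  moreover have "\<not> (p1 < q3 \<and> q3 < q2)" "\<not> (p1 < p3 \<and> p3 < q2)"
    by (rule no; simp)+
  ultimately show ?thesis
    using alternate_occurs_at[OF alt(1) x y] alternate_occurs_at[OF alt(2) x z]
      alternate_occurs_at[OF alt(3) y z]
    by linarith
qed

lemma card_gt_3_chain:
  fixes A :: "'a::linorder set"
  assumes "card A > 3"
  obtains a b c d where "{a, b, c, d} \<subseteq> A" "a < b" "b < c" "c < d"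
proof -
  define xs where "xs = sorted_list_of_set A"
  \<comment> \<open>An infinite set has \<open>card\<close> equal to 0, so the bound yields
    finiteness.\<close>
  have fin: "finite A" using assms card.infinite by fastforce
  then have xs: "sorted_wrt (<) xs" "set xs = A" "length xs > 3"
    using assms strict_sorted_list_of_set[of A] by (simp_all add: xs_def)
  have lt: "xs ! i < xs ! j" if "i < j" "j \<le> 3" for i j
    using sorted_wrt_nth_less[OF xs(1) that(1)] xs(3) that(2) by linarith
  have "xs ! i \<in> A" if "i \<le> 3" for i
    using nth_mem[of i xs] xs(2,3) that by simp
  then have "{xs ! 0, xs ! 1, xs ! 2, xs ! 3} \<subseteq> A" by simp
  moreover have "xs ! 0 < xs ! 1" "xs ! 1 < xs ! 2" "xs ! 2 < xs ! 3"
    by (rule lt; simp)+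
  ultimately show thesis by (rule that)
qed

text \<open>The graph-free core: completeness enters only as pairwise alternation of the
  labels.\<close>

lemma alternating_2_uniform_contains_132:
  fixes V :: "'a::linorder set"
  assumes "card V > 3" and unif: "uniform_word 2 V w"
    and alt: "\<And>x y. x \<in> V \<Longrightarrow> y \<in> V \<Longrightarrow> x \<noteq> y \<Longrightarrow> alternate x y w"
  shows "contains_132 w"
proof (rule ccontr)
  assume "\<not> contains_132 w"
  then have av: "avoids_132 w" by (simp add: avoids_132_def)
  obtain a b c d where V: "{a, b, c, d} \<subseteq> V" and less: "a < b" "b < c" "c < d"
    using card_gt_3_chain[OF assms(1)] .
  have "\<exists>p q. occurs_at w x p q" if "x \<in> V" for x
    using unif that by (meson count_list_2_occurs_at uniform_word_def)
  then obtain pa qa pb qb pc qc pd qd where occ: "occurs_at w a pa qa" "occurs_at w b pb qb"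
    "occurs_at w c pc qc" "occurs_at w d pd qd"
    using V by (metis insert_subset)
  have alts: "alternate a b w" "alternate a c w" "alternate b c w" "alternate b d w"
    "alternate c d w"
    using V less by (auto intro!: alt)
  have "pb < pc"
    using avoids_132_occurs_at_order[OF av less(1,2) alts(1-3) occ(1-3)] by blast
  moreover have "pc < pd \<and> pd < pb"
    using avoids_132_occurs_at_order[OF av less(2,3) alts(3-5) occ(2-4)] by blast
  ultimately show False by simp
qed

lemma arcs_ends_relabel: "arcs_ends (relabel f G) = map_prod f f ` arcs_ends G"
  by (force simp: arcs_ends_def arc_to_ends_def relabel_def)

theorem theorem4p5:
  fixes G :: "('v, 'e) pre_digraph" and n :: nat
  assumes "n > 3" and "complete_digraph n G"
  shows "\<not> (\<exists>(f :: 'v \<Rightarrow> 'a::linorder) w.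
            inj_on f (verts G) \<and>
            represents w (relabel f G) \<and>
            uniform_word 2 (verts (relabel f G)) w \<and>
            avoids_132 w)"
proof clarify
  fix f :: "'v \<Rightarrow> 'a" and w
  assume inj: "inj_on f (verts G)" and rep: "represents w (relabel f G)"
    and unif: "uniform_word 2 (verts (relabel f G)) w" and av: "avoids_132 w"
  have verts: "verts (relabel f G) = f ` verts G" by (simp add: relabel_def)
  have G: "card (verts G) = n" "arcs_ends G = {(u, v). (u, v) \<in> verts G \<times> verts G \<and> u \<noteq> v}"
    using assms(2) by (auto simp: complete_digraph_def)
  \<comment> \<open>Injectivity of \<open>f\<close> keeps the number of labels at
    \<open>n\<close>.\<close>
  have "card (verts (relabel f G)) > 3"
    using assms(1) G(1) inj by (simp add: verts card_image)
  moreover have "alternate x y w"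
    if xy: "x \<in> verts (relabel f G)" "y \<in> verts (relabel f G)" "x \<noteq> y" for x y
  proof -
    obtain u v where "x = f u" "y = f v" "u \<in> verts G" "v \<in> verts G"
      using xy by (auto simp: verts)
    \<comment> \<open>Distinct labels come from distinct vertices, which are adjacent in a complete
      graph.\<close>
    with xy(3) have "(x, y) \<in> arcs_ends (relabel f G)"
      by (force simp: arcs_ends_relabel G(2))
    with rep xy show ?thesis unfolding represents_def by blast
  qed
  ultimately have "contains_132 w"
    using alternating_2_uniform_contains_132 unif by blast
  with av show False by (simp add: avoids_132_def)
qed

end
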